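(* Let $f(q)=\sum_{j=0}^{n}a_jq^j$ be a palindromic real polynomial of darga $n$ (so $a_j=a_{n-j}$ for all $j$), and write $f(q)=\sum_{i=0}^{\lfloor n/2\rfloor}b_iq^i(1+q)^{n-2i}$ with $b_i\in\mathbb{R}$. Define, for $0\le j\le i\le\lfloor n/2\rfloor$, $c_{i,j}=(-1)^{i-j}\frac{n-2j}{n-i-j}\binom{n-i-j}{i-j}$, with the convention $c_{j,j}=1$ (this is needed only when $i=j=n/2$). Then: (i) for $0\le i\le\lfloor n/2\rfloor$, $b_i=\sum_{j=0}^{i}c_{i,j}a_j$; (ii) if all $a_j$ are integers, then all $b_i$ are integers; (iii) $f(q)$ is $\mathcal{B}$-positive (i.e. all $b_i\ge0$) if and only if $\sum_{j=0}^{i}c_{i,j}a_j\ge0$ for all $0\le i\le\lfloor n/2\rfloor$.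
   Context: For a nonzero real polynomial $f(q)=a_rq^r+\cdots+a_sq^s$ with $a_r\neq 0$, $a_s\neq 0$, its darga is $r+s$, and $f$ is palindromic if $a_{r+i}=a_{s-i}$ for all $i$. The polynomials $\{q^i(1+q)^{n-2i}\}_{i=0}^{\lfloor n/2\rfloor}$ form a basis of the space of palindromic polynomials of darga $n$; $f$ is $\mathcal{B}$-positive if its coordinates in this basis are all nonnegative. *)

theory Defs
  imports Complex_Main "HOL-Computational_Algebra.Polynomial"
begin

text \<open>The darga and palindromicity are only meaningful for nonzero polynomials:
  then the least index of a nonzero coefficient plays the role of \<open>r\<close> and the degree
  that of \<open>s\<close>.\<close>

definition low_degree :: "real poly \<Rightarrow> nat" where
  "low_degree f = (LEAST r. coeff f r \<noteq> 0)"

definition darga :: "real poly \<Rightarrow> nat" where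
  "darga f = low_degree f + degree f"

text \<open>Indices \<open>i\<close> beyond the stated bound only compare zero coefficients.\<close>

definition palindromic :: "real poly \<Rightarrow> bool" where
  "palindromic f \<longleftrightarrow>
     (\<forall>i \<le> degree f - low_degree f. coeff f (low_degree f + i) = coeff f (degree f - i))"

text \<open>The zero polynomial, which has no darga of its own, belongs to the space for every \<open>n\<close>.\<close>

definition palindromic_of_darga :: "nat \<Rightarrow> real poly set" where
  "palindromic_of_darga n = {f. f = 0 \<or> (palindromic f \<and> darga f = n)}"

definition B_basis :: "nat \<Rightarrow> nat \<Rightarrow> real poly" where
  "B_basis n i = [:0, 1:] ^ i * [:1, 1:] ^ (n - 2 * i)"

definition B_positive :: "nat \<Rightarrow> real poly \<Rightarrow> bool" where
  "B_positive n f \<longleftrightarrow>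
     (\<exists>b. f = (\<Sum>i\<le>n div 2. smult (b i) (B_basis n i)) \<and> (\<forall>i \<le> n div 2. b i \<ge> 0))"

text \<open>Intended for \<open>j \<le> i \<le> n div 2\<close>. The case \<open>i = j\<close> agrees with the general
  formula unless \<open>i = j = n/2\<close>, where the formula would read \<open>0/0\<close>.\<close>

definition c_coeff :: "nat \<Rightarrow> nat \<Rightarrow> nat \<Rightarrow> real" where
  "c_coeff n i j =
     (if i = j then 1
      else (-1) ^ (i - j) * ((real n - 2 * real j) / (real n - real i - real j))
             * real ((n - i - j) choose (i - j)))"

text \<open>The polynomials \<^term>\<open>B_basis n i\<close> with \<open>i \<le> n div 2\<close> form a basis of
  \<^term>\<open>palindromic_of_darga n\<close>, so the witness \<open>b\<close> in \<^const>\<open>B_positive\<close> is the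
  coordinate vector.\<close>

lemma palindromic_of_darga_coeff:
  assumes "f \<in> palindromic_of_darga n"
  shows "degree f \<le> n" and "j \<le> n \<Longrightarrow> coeff f (n - j) = coeff f j"
proof -
  have *: "degree f \<le> n \<and> (\<forall>j\<le>n. coeff f (n - j) = coeff f j)"
  proof (cases "f = 0")
    case False
    let ?r = "low_degree f" and ?s = "degree f"
    have nz: "coeff f ?s \<noteq> 0" using False by simp
    have rs: "?r \<le> ?s" unfolding low_degree_def using nz by (rule Least_le)
    have below: "coeff f k = 0" if "k < ?r" for k
      using not_less_Least[of k "\<lambda>r. coeff f r \<noteq> 0"] that unfolding low_degree_def by blast
    have n: "n = ?r + ?s" and p: "palindromic f"
      using assms False by (auto simp: palindromic_of_darga_def darga_def)
    have "coeff f (n - j) = coeff f j" if "j \<le> n" for j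
    proof (cases "j < ?r \<or> ?s < j")
      case True
      then show ?thesis
        using n that rs below[of "n - j"] below[of j] coeff_eq_0[of f j] coeff_eq_0[of f "n - j"]
        by (cases "j < ?r") auto
    next
      case False
      then have "coeff f (?r + (j - ?r)) = coeff f (?s - (j - ?r))"
        using p unfolding palindromic_def by (metis diff_le_mono not_less)
      moreover have "?r + (j - ?r) = j" "?s - (j - ?r) = n - j" using False n by auto
      ultimately show ?thesis by simp
    qed
    then show ?thesis using n by auto
  qed auto
  show "degree f \<le> n" "j \<le> n \<Longrightarrow> coeff f (n - j) = coeff f j" using * by auto
qed

lemma palindromic_of_dargaI:
  assumes "degree f \<le> n" and "\<And>j. j \<le> n \<Longrightarrow> coeff f (n - j) = coeff f j"
  shows "f \<in> palindromic_of_darga n"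
proof (cases "f = 0")
  case False
  let ?r = "low_degree f" and ?s = "degree f"
  have nz: "coeff f ?s \<noteq> 0" using False by simp
  have nzr: "coeff f ?r \<noteq> 0" unfolding low_degree_def using nz by (rule LeastI)
  have rs: "?r \<le> ?s" unfolding low_degree_def using nz by (rule Least_le)
  have "coeff f (n - ?s) \<noteq> 0" using assms nz by simp
  then have 1: "?r \<le> n - ?s" unfolding low_degree_def by (rule Least_le)
  have "coeff f (n - ?r) \<noteq> 0" using assms(2)[of ?r] nzr rs assms(1) by simp
  then have 2: "n - ?r \<le> ?s" by (rule le_degree)
  have n: "n = ?r + ?s" using 1 2 rs assms(1) by linarith
  have "palindromic f" unfolding palindromic_def
  proof (intro allI impI)
    fix i assume "i \<le> ?s - ?r"
    then have "?r + i \<le> n" "n - (?r + i) = ?s - i" using n rs by auto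
    then show "coeff f (?r + i) = coeff f (?s - i)" using assms(2)[of "?r + i"] by simp
  qed
  then show ?thesis using n by (simp add: palindromic_of_darga_def darga_def)
qed (simp add: palindromic_of_darga_def)

lemma coeff_B_basis:
  "coeff (B_basis n i) k = (if k < i then 0 else real ((n - 2 * i) choose (k - i)))"
proof -
  have "[:0, 1:] ^ i = monom (1::real) i" by (simp add: monom_altdef)
  moreover have "coeff ([:1, 1:] ^ m) l = real (m choose l)" for m l
    by (cases "l \<le> m")
       (simp_all add: coeff_linear_poly_power coeff_eq_0 degree_linear_power)
  ultimately show ?thesis by (simp add: B_basis_def coeff_monom_mult)
qed

lemma B_basis_independent:
  assumes "(\<Sum>i\<le>n div 2. smult (b i) (B_basis n i)) = 0"
  shows "i \<le> n div 2 \<Longrightarrow> b i = 0"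
proof (induction i rule: less_induct)
  case (less i)
  have "0 = coeff (\<Sum>k\<le>n div 2. smult (b k) (B_basis n k)) i" using assms by simp
  also have "\<dots> = (\<Sum>k\<le>n div 2. b k * coeff (B_basis n k) i)" by (simp add: coeff_sum)
  also have "\<dots> = (\<Sum>k\<in>{i}. b k * coeff (B_basis n k) i)"
  proof (rule sum.mono_neutral_right)
    show "\<forall>k\<in>{..n div 2} - {i}. b k * coeff (B_basis n k) i = 0"
    proof
      fix k assume "k \<in> {..n div 2} - {i}"
      then show "b k * coeff (B_basis n k) i = 0"
        using less.IH[of k] by (cases "k < i") (auto simp: coeff_B_basis)
    qed
  qed (use less.prems in auto)
  also have "\<dots> = b i" by (simp add: coeff_B_basis)
  finally show ?case by simp
qed

lemma B_basis_in_space: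
  assumes "i \<le> n div 2"
  shows "B_basis n i \<in> palindromic_of_darga n"
proof (rule palindromic_of_dargaI)
  show "degree (B_basis n i) \<le> n"
    using assms by (intro degree_le) (auto simp: coeff_B_basis)
next
  fix j assume j: "j \<le> n"
  consider "j < i" | "n < i + j" | "i \<le> j" "i + j \<le> n" by linarith
  then show "coeff (B_basis n i) (n - j) = coeff (B_basis n i) j"
  proof cases
    case 3
    then have "n - 2 * i - (j - i) = n - j - i" by auto
    then show ?thesis
      using 3 binomial_symmetric[of "j - i" "n - 2 * i"] by (auto simp: coeff_B_basis)
  qed (use j assms in \<open>auto simp: coeff_B_basis\<close>)
qed

lemma B_basis_spans:
  assumes "f \<in> palindromic_of_darga n"
  shows "\<exists>b. f = (\<Sum>i\<le>n div 2. smult (b i) (B_basis n i))"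
proof -
  have "\<exists>b. \<forall>k<m. coeff f k = coeff (\<Sum>i\<le>n div 2. smult (b i) (B_basis n i)) k"
    if "m \<le> Suc (n div 2)" for m
    using that
  proof (induction m)
    case (Suc m)
    then obtain b
      where b: "\<And>k. k < m \<Longrightarrow> coeff f k = coeff (\<Sum>i\<le>n div 2. smult (b i) (B_basis n i)) k"
      by fastforce
    define d where "d = coeff f m - coeff (\<Sum>i\<le>n div 2. smult (b i) (B_basis n i)) m"
    define b' where "b' i = b i + (if i = m then d else 0)" for i
    have "(\<Sum>i\<le>n div 2. smult (b' i) (B_basis n i)) =
        (\<Sum>i\<le>n div 2. smult (b i) (B_basis n i)) +
        (\<Sum>i\<le>n div 2. if i = m then smult d (B_basis n i) else 0)"
      unfolding sum.distrib[symmetric]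
      by (intro sum.cong) (auto simp: b'_def smult_add_left)
    also have "\<dots> = (\<Sum>i\<le>n div 2. smult (b i) (B_basis n i)) + smult d (B_basis n m)"
      using Suc.prems by simp
    finally have e: "(\<Sum>i\<le>n div 2. smult (b' i) (B_basis n i)) =
      (\<Sum>i\<le>n div 2. smult (b i) (B_basis n i)) + smult d (B_basis n m)" .
    have "coeff f k = coeff (\<Sum>i\<le>n div 2. smult (b' i) (B_basis n i)) k" if "k < Suc m" for k
      using that b[of k] unfolding e
      by (cases "k = m") (auto simp: coeff_B_basis d_def)
    then show ?case by blast
  qed auto
  then obtain b where b: "\<And>k. k \<le> n div 2 \<Longrightarrow>
      coeff f k = coeff (\<Sum>i\<le>n div 2. smult (b i) (B_basis n i)) k"
    by (metis less_Suc_eq_le order_refl)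
  let ?g = "\<Sum>i\<le>n div 2. smult (b i) (B_basis n i)"
  have low: "coeff ?g k = (\<Sum>i\<le>n div 2. b i * coeff (B_basis n i) k)" for k
    by (simp add: coeff_sum)
  have "coeff f k = coeff ?g k" for k
  proof -
    consider "k \<le> n div 2" | "n div 2 < k" "k \<le> n" | "n < k" by linarith
    then show ?thesis
    proof cases
      case 2
      have "n - k \<le> n div 2" using 2 by linarith
      then have "coeff f (n - k) = coeff ?g (n - k)" by (rule b)
      also have "\<dots> = coeff ?g k"
        unfolding low using 2
        by (intro sum.cong) (auto simp: palindromic_of_darga_coeff(2)[OF B_basis_in_space])
      finally show ?thesis using palindromic_of_darga_coeff(2)[OF assms 2(2)] by simp
    next
      case 3
      then have "coeff f k = 0"
        using palindromic_of_darga_coeff(1)[OF assms] by (intro coeff_eq_0) simp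
      moreover have "coeff ?g k = 0"
        unfolding low using 3 by (intro sum.neutral) (auto simp: coeff_B_basis)
      ultimately show ?thesis by simp
    qed (rule b)
  qed
  then show ?thesis using poly_eq_iff by blast
qed

end

theory Submission
  imports Defs "HOL-Computational_Algebra.Formal_Power_Series"
begin

text \<open>Comparing coefficients gives the triangular system \<open>a\<^sub>j = (\<Sum>k\<le>j. (n - 2k choose j - k) b\<^sub>k)\<close>.
  Putting \<open>z = 2i - n - 1\<close>, the entry \<open>c\<^sub>i\<^sub>j\<close> is the difference of the generalized binomials
  \<open>z gchoose (i - j)\<close> and \<open>z gchoose (i - j - 1)\<close>, so that Vandermonde convolution sums
  \<open>c\<^sub>i\<^sub>j (n - 2k choose j - k)\<close> over \<open>j\<close> to \<open>(2d - 1 choose d) - (2d - 1 choose d - 1)\<close>,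
  where \<open>d = i - k\<close>. This vanishes unless \<open>d = 0\<close>.\<close>

lemma c_coeff_altdef:
  assumes "j \<le> i" and "i \<le> n div 2"
  shows "c_coeff n i j =
    ((2 * real i - real n - 1) gchoose (i - j)) -
    (if i = j then 0 else (2 * real i - real n - 1) gchoose (i - j - 1))"
proof (cases "i = j")
  case False
  define e N where "e = i - j" and "N = n - i - j"
  have e: "0 < e" and N: "e \<le> N" using assms False by (auto simp: e_def N_def)
  have rN: "real N = real n - real i - real j" and re: "real e = real i - real j"
    using assms by (auto simp: N_def e_def of_nat_diff)
  \<comment> \<open>Upper negation replaces the index \<open>2i - n - 1\<close> by
    \<open>e - (2i - n - 1) - 1 = N\<close>; with lower index \<open>e - 1\<close> the result is
    \<open>N - 1\<close>.\<close>
  have top: "((2 * real i - real n - 1) gchoose e) = (-1) ^ e * real (N choose e)"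
    by (subst gbinomial_negated_upper) (simp add: rN re binomial_gbinomial algebra_simps)
  have "(2 * real i - real n - 1) gchoose (e - 1) = (-1) ^ (e - 1) * real ((N - 1) choose (e - 1))"
    using e N
    by (subst gbinomial_negated_upper)
       (simp add: rN re binomial_gbinomial of_nat_diff algebra_simps)
  also have "\<dots> = - ((-1) ^ e * real ((N - 1) choose (e - 1)))"
    using e by (cases e) auto
  finally have sub: "(2 * real i - real n - 1) gchoose (e - 1) =
      - ((-1) ^ e * real ((N - 1) choose (e - 1)))" .
  have "real (e * (N choose e)) = real (N * ((N - 1) choose (e - 1)))"
    using times_binomial_minus1_eq[OF e, of N] by simp
  then have absorb: "real ((N - 1) choose (e - 1)) = real e / real N * real (N choose e)"
    using e N by (simp add: field_simps)
  \<comment> \<open>The 1 accounts for \<open>N choose e\<close>, and by \<open>absorb\<close> the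
    remainder \<open>e / N\<close> accounts for \<open>(N - 1) choose (e - 1)\<close>.\<close>
  have quot: "(real n - 2 * real j) / real N = 1 + real e / real N"
  proof -
    have "real n - 2 * real j = real N + real e" by (simp add: rN re)
    then show ?thesis using e N by (simp add: add_divide_distrib)
  qed
  have "c_coeff n i j = (-1) ^ e * ((real n - 2 * real j) / real N) * real (N choose e)"
    using False unfolding c_coeff_def rN unfolding e_def N_def by simp
  also have "\<dots> = (-1) ^ e * (real (N choose e) + real ((N - 1) choose (e - 1)))"
    unfolding quot absorb by (simp add: algebra_simps)
  finally show ?thesis
    using False top sub by (simp add: e_def algebra_simps)
qed (simp add: c_coeff_def)

text \<open>Vandermonde convolution after the shift \<open>l = j - k\<close>. The index
  \<open>z\<close> is real because it will be the negative number \<open>2i - n - 1\<close>.\<close>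

lemma sum_binomial_gbinomial_shifted:
  assumes "k \<le> i"
  shows "(\<Sum>j=k..i. (z gchoose (i - j)) * real (m choose (j - k))) =
    ((real m + z) gchoose (i - k))"
proof -
  have "(\<Sum>j=k..i. (z gchoose (i - j)) * real (m choose (j - k))) =
      (\<Sum>l\<le>i - k. (real m gchoose l) * (z gchoose (i - k - l)))"
    using assms
    by (intro sum.reindex_bij_witness[of _ "\<lambda>l. l + k" "\<lambda>j. j - k"])
       (auto simp: binomial_gbinomial)
  then show ?thesis unfolding atMost_atLeast0 gbinomial_Vandermonde .
qed

text \<open>The matrix \<open>c_coeff\<close> is a left inverse of the unitriangular matrix that
  takes coordinates to coefficients.\<close>

lemma c_coeff_orthogonal:
  assumes "k \<le> i" and "i \<le> n div 2"
  shows "(\<Sum>j=k..i. c_coeff n i j * real ((n - 2 * k) choose (j - k))) = (if i = k then 1 else 0)"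
proof (cases "i = k")
  case False
  define z d where "z = 2 * real i - real n - 1" and "d = i - k"
  have d: "0 < d" "real d = real i - real k"
    using assms False by (auto simp: d_def of_nat_diff)
  \<comment> \<open>Here \<open>n\<close> cancels, and \<open>d > 0\<close> makes the index a
    natural number, so ordinary binomials result.\<close>
  have m: "real (n - 2 * k) + z = real (2 * d - 1)"
    using assms d by (simp add: z_def of_nat_diff)
  obtain i' where i': "i = Suc i'" "k \<le> i'"
    using assms(1) False by (cases i) auto
  have "(\<Sum>j=k..i. c_coeff n i j * real ((n - 2 * k) choose (j - k))) =
      (\<Sum>j=k..i. (z gchoose (i - j)) * real ((n - 2 * k) choose (j - k))) -
      (\<Sum>j=k..i. (if i = j then 0 else z gchoose (i - j - 1)) * real ((n - 2 * k) choose (j - k)))"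
    unfolding sum_subtractf[symmetric] z_def
    using assms by (intro sum.cong) (auto simp: c_coeff_altdef algebra_simps)
  \<comment> \<open>The term \<open>j = i\<close> vanishes; what remains is the same convolution
    with \<open>i'\<close> for \<open>i\<close>, whence the lower index
    \<open>d - 1\<close>.\<close>
  also have "(\<Sum>j=k..i. (if i = j then 0 else z gchoose (i - j - 1)) *
        real ((n - 2 * k) choose (j - k))) =
      (\<Sum>j=k..i'. (z gchoose (i' - j)) * real ((n - 2 * k) choose (j - k)))"
    using i' by (auto intro!: sum.cong simp: Suc_diff_le)
  also have "\<dots> = real ((2 * d - 1) choose (d - 1))"
    unfolding sum_binomial_gbinomial_shifted[OF i'(2)] m
    using i' by (simp add: binomial_gbinomial d_def)
  also have "(\<Sum>j=k..i. (z gchoose (i - j)) * real ((n - 2 * k) choose (j - k))) =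
      real ((2 * d - 1) choose d)"
    unfolding sum_binomial_gbinomial_shifted[OF assms(1)] m
    by (simp add: binomial_gbinomial d_def)
  also have "(2 * d - 1) choose d = (2 * d - 1) choose (d - 1)"
    using d binomial_symmetric[of d "2 * d - 1"] by (simp add: mult_2)
  finally show ?thesis using False by simp
qed (simp add: c_coeff_def)

text \<open>Since \<open>q^k\<close> divides \<open>B_basis n k\<close>, only the terms with
  \<open>k \<le> j\<close> contribute.\<close>

lemma coeff_B_expansion:
  assumes "f = (\<Sum>i\<le>n div 2. smult (b i) (B_basis n i))" and "j \<le> n div 2"
  shows "coeff f j = (\<Sum>k\<le>j. b k * real ((n - 2 * k) choose (j - k)))"
proof -
  have "coeff f j = (\<Sum>k\<le>n div 2. b k * coeff (B_basis n k) j)"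
    by (simp add: assms(1) coeff_sum)
  also have "\<dots> = (\<Sum>k\<le>j. b k * coeff (B_basis n k) j)"
    using assms(2) by (intro sum.mono_neutral_right) (auto simp: coeff_B_basis)
  finally show ?thesis by (simp add: coeff_B_basis)
qed

lemma B_coordinate_eq:
  assumes "f = (\<Sum>i\<le>n div 2. smult (b i) (B_basis n i))" and "i \<le> n div 2"
  shows "b i = (\<Sum>j\<le>i. c_coeff n i j * coeff f j)"
proof -
  have "(\<Sum>j\<le>i. c_coeff n i j * coeff f j) =
      (\<Sum>j\<le>i. \<Sum>k\<le>j. c_coeff n i j * (b k * real ((n - 2 * k) choose (j - k))))"
    using assms(2) by (intro sum.cong) (auto simp: coeff_B_expansion[OF assms(1)] sum_distrib_left)
  \<comment> \<open>Summing over the triangle \<open>k \<le> j \<le> i\<close> by columns isolates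
    the factor of each \<open>b k\<close>.\<close>
  also have "\<dots> = (\<Sum>k\<le>i. \<Sum>j=k..i. c_coeff n i j * (b k * real ((n - 2 * k) choose (j - k))))"
    unfolding sum.Sigma[OF finite_atMost ballI[OF finite_atMost]]
      sum.Sigma[OF finite_atMost ballI[OF finite_atLeastAtMost]]
    by (rule sum.reindex_bij_witness[of _ prod.swap prod.swap]) auto
  also have "\<dots> = (\<Sum>k\<le>i. b k * (\<Sum>j=k..i. c_coeff n i j * real ((n - 2 * k) choose (j - k))))"
    by (simp add: sum_distrib_left mult.left_commute)
  also have "\<dots> = (\<Sum>k\<le>i. if i = k then b k else 0)"
    using assms(2) by (intro sum.cong) (auto simp: c_coeff_orthogonal)
  finally show ?thesis by simp
qed

text \<open>The quotient in \<open>c_coeff\<close> hides integrality. The system for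
  \<open>b\<close> has integer entries and unit diagonal, so forward substitution stays within the
  integers.\<close>

lemma B_coordinate_Ints:
  assumes "f = (\<Sum>i\<le>n div 2. smult (b i) (B_basis n i))"
    and "\<And>j. j \<le> n div 2 \<Longrightarrow> coeff f j \<in> \<int>"
  shows "i \<le> n div 2 \<Longrightarrow> b i \<in> \<int>"
proof (induction i rule: less_induct)
  case (less i)
  have "{..i} = insert i {..<i}" by auto
  then have "b i = coeff f i - (\<Sum>k<i. b k * real ((n - 2 * k) choose (i - k)))"
    by (simp add: coeff_B_expansion[OF assms(1) less.prems])
  also have "\<dots> \<in> \<int>"
    using less assms(2) by (intro Ints_diff Ints_sum Ints_mult) auto
  finally show ?case .
qed

theorem theorem3p2:
  fixes f :: "real poly" and a b :: "nat \<Rightarrow> real" and n :: nat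
  assumes "f = (\<Sum>j\<le>n. monom (a j) j)"
    and "f \<in> palindromic_of_darga n"
    and "f = (\<Sum>i\<le>n div 2. smult (b i) (B_basis n i))"
  shows "(\<forall>i \<le> n div 2. b i = (\<Sum>j\<le>i. c_coeff n i j * a j)) \<and>
         ((\<forall>j \<le> n. a j \<in> \<int>) \<longrightarrow> (\<forall>i \<le> n div 2. b i \<in> \<int>)) \<and>
         (B_positive n f \<longleftrightarrow> (\<forall>i \<le> n div 2. (\<Sum>j\<le>i. c_coeff n i j * a j) \<ge> 0))"
proof -
  have a: "coeff f j = a j" if "j \<le> n" for j
    using that by (simp add: assms(1) coeff_sum)
  \<comment> \<open>Stated for any coordinate vector, so that it also covers the witness hidden in
    \<open>B_positive\<close>.\<close>
  have coord: "b' i = (\<Sum>j\<le>i. c_coeff n i j * a j)"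
    if "f = (\<Sum>i\<le>n div 2. smult (b' i) (B_basis n i))" "i \<le> n div 2" for b' i
    using B_coordinate_eq[OF that] that(2) by (simp add: a)
  have "b i \<in> \<int>" if "\<forall>j\<le>n. a j \<in> \<int>" "i \<le> n div 2" for i
    using B_coordinate_Ints[OF assms(3) _ that(2)] that(1) by (simp add: a)
  moreover have "B_positive n f \<longleftrightarrow> (\<forall>i \<le> n div 2. (\<Sum>j\<le>i. c_coeff n i j * a j) \<ge> 0)"
  proof
    assume "B_positive n f"
    then show "\<forall>i \<le> n div 2. (\<Sum>j\<le>i. c_coeff n i j * a j) \<ge> 0"
      unfolding B_positive_def using coord by metis
  next
    assume "\<forall>i \<le> n div 2. (\<Sum>j\<le>i. c_coeff n i j * a j) \<ge> 0"
    then show "B_positive n f"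
      unfolding B_positive_def using coord[OF assms(3)] assms(3) by metis
  qed
  ultimately show ?thesis using coord[OF assms(3)] by blast
qed

end
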